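(* Let $D=(V,A)$ be a finite connected monotone bipartite digraph; that is, $V$ is the disjoint union of nonempty sets $V_1,V_2$ and every arc $(u,v)\in A$ satisfies $u\in V_1$ and $v\in V_2$. Then $$\eta_t(D)=\max\left\{\left\lfloor\frac{d(u)}{d(v)}\right\rfloor+1 : v\in V_2,\ u\in N(v)\right\}.$$
   Context: For a directed acyclic graph $D=(V,A)$, $N(v)$ denotes the set of neighbors of $v$ in the undirected underlying graph of $D$ (both in- and out-neighbors), and $d(v)=|N(v)|$. $\mathbb{N}$ denotes the positive integers. For a labeling $f:V\to\mathbb{N}$, put $S(v)=\sum_{w\in N(v)}f(w)$. The labeling $f$ is a topological additive numbering of $D$ if $S(u)<S(v)$ for every $(u,v)\in A$; it is a topological additive $k$-numbering if moreover $k$ is the largest label used in $f$. If $D$ has at least one topological additive numbering, $\eta_t(D)$ is the least $k$ for which $D$ has a topological additive $k$-numbering; the assertion includes that $\eta_t(D)$ is defined, i.e. that $D$ has a topological additive numbering. *)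

theory Defs
  imports Complex_Main "Graph_Theory.Graph_Theory"
begin

definition neighbors :: "'a pair_pre_digraph \<Rightarrow> 'a \<Rightarrow> 'a set" where
  "neighbors D v = {w. (v, w) \<in> parcs (mk_symmetric (with_proj D))}"

definition degree :: "'a pair_pre_digraph \<Rightarrow> 'a \<Rightarrow> nat" where
  "degree D v = card (neighbors D v)"

definition label_sum :: "'a pair_pre_digraph \<Rightarrow> ('a \<Rightarrow> nat) \<Rightarrow> 'a \<Rightarrow> nat" where
  "label_sum D f v = (\<Sum>w\<in>neighbors D v. f w)"

(* Labels are positive integers on the vertices of D; values of f elsewhere are irrelevant. *)
definition topological_additive_numbering :: "'a pair_pre_digraph \<Rightarrow> ('a \<Rightarrow> nat) \<Rightarrow> bool" where
  "topological_additive_numbering D f \<longleftrightarrow>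
     (\<forall>v\<in>pverts D. f v > 0) \<and>
     (\<forall>(u, v)\<in>parcs D. label_sum D f u < label_sum D f v)"

(* k has to occur as a label: it is the largest label, not merely an upper bound. *)
definition topological_additive_k_numbering ::
    "'a pair_pre_digraph \<Rightarrow> nat \<Rightarrow> ('a \<Rightarrow> nat) \<Rightarrow> bool" where
  "topological_additive_k_numbering D k f \<longleftrightarrow>
     topological_additive_numbering D f \<and>
     k \<in> f ` pverts D \<and> (\<forall>v\<in>pverts D. f v \<le> k)"

(* Only meaningful for digraphs that have a topological additive numbering;
   otherwise LEAST returns an unspecified value. *)
definition eta_t :: "'a pair_pre_digraph \<Rightarrow> nat" where
  "eta_t D = (LEAST k. \<exists>f. topological_additive_k_numbering D k f)"

definition monotone_bipartite :: "'a pair_pre_digraph \<Rightarrow> 'a set \<Rightarrow> 'a set \<Rightarrow> bool" where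
  "monotone_bipartite D V1 V2 \<longleftrightarrow>
     pverts D = V1 \<union> V2 \<and> V1 \<inter> V2 = {} \<and> V1 \<noteq> {} \<and> V2 \<noteq> {} \<and> parcs D \<subseteq> V1 \<times> V2"

(* The notions above are intended for acyclic digraphs. No acyclicity hypothesis is
   needed for monotone bipartite digraphs. *)
lemma monotone_bipartite_acyclic:
  assumes "monotone_bipartite D V1 V2"
  shows "acyclic (parcs D)"
proof (rule acyclicI, intro allI notI)
  fix x assume c: "(x, x) \<in> (parcs D)\<^sup>+"
  from c obtain y where "(x, y) \<in> parcs D" by (blast dest: tranclD)
  moreover from c obtain z where "(z, x) \<in> parcs D" by (blast dest: tranclD2)
  ultimately show False using assms unfolding monotone_bipartite_def by blast
qed

lemma neighbors_iff:
  "w \<in> neighbors D v \<longleftrightarrow> (v, w) \<in> parcs D \<or> (w, v) \<in> parcs D"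
  by (auto simp: neighbors_def mk_symmetric_def intro: bexI[of _ "(w, v)"])

end

theory Submission
  imports Defs
begin

text \<open>With all labels between 1 and \<open>k\<close>, an arc from \<open>u\<close> to \<open>v\<close> forces
  \<open>d(u) \<le> S(u) < S(v) \<le> k d(v)\<close>. Labelling \<open>V\<^sub>1\<close> by \<open>k\<close> and \<open>V\<^sub>2\<close> by 1 turns the two outer
  inequalities into equalities, so \<open>k\<close> is attained exactly when \<open>d(u) < k d(v)\<close> for every arc,
  that is, when \<open>k\<close> is at least every \<open>\<lfloor>d(u) / d(v)\<rfloor> + 1\<close>.\<close>

lemma neighbors_subset_pverts:
  assumes "pair_fin_digraph D"
  shows "neighbors D v \<subseteq> pverts D"
proof -
  interpret pair_fin_digraph D by fact
  show ?thesis
    by (auto simp: neighbors_iff dest: in_arcsD1 in_arcsD2)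
qed

lemma finite_neighbors:
  assumes "pair_fin_digraph D"
  shows "finite (neighbors D v)"
  using neighbors_subset_pverts[OF assms] pair_fin_digraph.pair_finite_verts[OF assms]
  by (rule finite_subset)

lemma degree_pos:
  assumes "pair_fin_digraph D" "w \<in> neighbors D v"
  shows "degree D v > 0"
  using finite_neighbors[OF assms(1), of v] assms(2) by (auto simp: degree_def card_gt_0_iff)

lemma degree_le_label_sum:
  assumes "pair_fin_digraph D" "\<And>w. w \<in> pverts D \<Longrightarrow> f w > 0"
  shows "degree D v \<le> label_sum D f v"
proof -
  have "1 \<le> f w" if "w \<in> neighbors D v" for w
    using assms(2)[OF subsetD[OF neighbors_subset_pverts[OF assms(1)] that]] by simp
  then have "card (neighbors D v) * 1 \<le> label_sum D f v"
    unfolding label_sum_def using sum_bounded_below[of "neighbors D v" 1 f] by simp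
  then show ?thesis by (simp add: degree_def)
qed

lemma label_sum_le_degree:
  assumes "pair_fin_digraph D" "\<And>w. w \<in> pverts D \<Longrightarrow> f w \<le> k"
  shows "label_sum D f v \<le> k * degree D v"
proof -
  have "f w \<le> k" if "w \<in> neighbors D v" for w
    using subsetD[OF neighbors_subset_pverts[OF assms(1)] that] by (rule assms(2))
  then show ?thesis
    unfolding label_sum_def degree_def using sum_bounded_above[of "neighbors D v" f k]
    by (simp add: mult.commute)
qed

lemma label_sum_const:
  assumes "\<And>w. w \<in> neighbors D v \<Longrightarrow> f w = c"
  shows "label_sum D f v = c * degree D v"
  using assms by (simp add: label_sum_def degree_def mult.commute)

text \<open>A path from \<open>v\<close> to the distinct vertex \<open>u\<close> in the symmetrized
  digraph has a first arc, whose head is the desired neighbor. This later ensures that the maximum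
  ranges over a nonempty set.\<close>

lemma connected_neighbor_exists:
  assumes "connected (with_proj D)" "u \<in> pverts D" "v \<in> pverts D" "u \<noteq> v"
  shows "\<exists>w. w \<in> neighbors D v"
proof -
  have "v \<rightarrow>\<^sup>*\<^bsub>with_proj (mk_symmetric (with_proj D))\<^esub> u"
    using assms(1-3) by (auto simp: connected_def strongly_connected_def)
  then have "\<exists>w. (v, w) \<in> parcs (mk_symmetric (with_proj D))"
    using assms(4) by (cases rule: pre_digraph.converse_reachable_cases) auto
  then show ?thesis by (simp add: neighbors_def)
qed

text \<open>The floor is \<open>a div b\<close>, and over the integers adding 1 turns \<le> into a
  strict inequality, which can then be multiplied out because \<open>b\<close> is positive.\<close>

lemma floor_quotient_plus_one_le_iff:
  fixes a b k :: nat
  assumes "b > 0"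
  shows "\<lfloor>real a / real b\<rfloor> + 1 \<le> int k \<longleftrightarrow> a < k * b"
proof -
  have "\<lfloor>real a / real b\<rfloor> + 1 \<le> int k \<longleftrightarrow> a div b < k"
    by (simp add: floor_divide_of_nat_eq) linarith
  also have "\<dots> \<longleftrightarrow> a < k * b"
    using assms by (rule div_less_iff_less_mult)
  finally show ?thesis .
qed

lemma k_numbering_degree_less:
  assumes "pair_fin_digraph D" "topological_additive_k_numbering D k f" "(u, v) \<in> parcs D"
  shows "degree D u < k * degree D v"
proof -
  have f: "\<And>w. w \<in> pverts D \<Longrightarrow> f w > 0" "\<And>w. w \<in> pverts D \<Longrightarrow> f w \<le> k"
    and less: "label_sum D f u < label_sum D f v"
    using assms(2,3)
    by (auto simp: topological_additive_k_numbering_def topological_additive_numbering_def)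
  have "degree D u \<le> label_sum D f u"
    using assms(1) f(1) by (rule degree_le_label_sum)
  also note less
  also have "label_sum D f v \<le> k * degree D v"
    using assms(1) f(2) by (rule label_sum_le_degree)
  finally show ?thesis .
qed

lemma two_label_k_numbering:
  assumes "monotone_bipartite D V1 V2" "k > 0"
    and less: "\<And>u v. (u, v) \<in> parcs D \<Longrightarrow> degree D u < k * degree D v"
  shows "topological_additive_k_numbering D k (\<lambda>v. if v \<in> V1 then k else 1)"
    (is "topological_additive_k_numbering D k ?f")
proof -
  from assms(1) have V: "pverts D = V1 \<union> V2" "V1 \<inter> V2 = {}" "V1 \<noteq> {}"
    and A: "parcs D \<subseteq> V1 \<times> V2"
    unfolding monotone_bipartite_def by blast+
  have "label_sum D ?f u < label_sum D ?f v" if uv: "(u, v) \<in> parcs D" for u v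
  proof -
    have "u \<in> V1" "v \<in> V2" using uv A by auto
    \<comment> \<open>Arcs only run from \<open>V1\<close> to \<open>V2\<close>, so neighbors always
      lie on the opposite side and each of the two sums has a constant summand.\<close>
    have "w \<notin> V1" if "w \<in> neighbors D u" for w
      using that \<open>u \<in> V1\<close> V(2) A unfolding neighbors_iff by blast
    then have "label_sum D ?f u = 1 * degree D u"
      by (intro label_sum_const) simp
    moreover have "w \<in> V1" if "w \<in> neighbors D v" for w
      using that \<open>v \<in> V2\<close> V(2) A unfolding neighbors_iff by blast
    then have "label_sum D ?f v = k * degree D v"
      by (intro label_sum_const) simp
    ultimately show ?thesis using less[OF uv] by simp
  qed
  \<comment> \<open>The label \<open>k\<close> really occurs, since \<open>V1\<close> is
    nonempty.\<close>
  moreover have "k \<in> ?f ` pverts D" using V by auto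
  ultimately show ?thesis
    using \<open>k > 0\<close>
    by (auto simp: topological_additive_k_numbering_def topological_additive_numbering_def)
qed

theorem proposition4:
  fixes D :: "'a pair_pre_digraph" and V1 V2 :: "'a set"
  assumes "pair_fin_digraph D"
    and "connected (with_proj D)"
    and "monotone_bipartite D V1 V2"
  shows "(\<exists>f. topological_additive_numbering D f) \<and>
    int (eta_t D) =
      Max {\<lfloor>real (degree D u) / real (degree D v)\<rfloor> + 1 | u v. v \<in> V2 \<and> u \<in> neighbors D v}"
    (is "_ \<and> _ = Max ?Q")
proof -
  from assms(3) have V: "pverts D = V1 \<union> V2" "V1 \<inter> V2 = {}" "V1 \<noteq> {}" "V2 \<noteq> {}"
    and A: "parcs D \<subseteq> V1 \<times> V2"
    unfolding monotone_bipartite_def by blast+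
  \<comment> \<open>A neighbor of a vertex of \<open>V2\<close> can only be the tail of an arc into
    it, so the pairs in \<open>?Q\<close> are exactly the arcs.\<close>
  have Q_eq: "?Q = (\<lambda>(u, v). \<lfloor>real (degree D u) / real (degree D v)\<rfloor> + 1) ` parcs D"
    (is "_ = ?q ` _")
  proof (intro set_eqI iffI)
    fix q assume "q \<in> ?Q"
    then obtain u v where q: "q = ?q (u, v)" and v: "v \<in> V2" "u \<in> neighbors D v" by auto
    have "(u, v) \<in> parcs D"
      using v V(2) A unfolding neighbors_iff by blast
    with q show "q \<in> ?q ` parcs D" by (rule image_eqI)
  next
    fix q assume "q \<in> ?q ` parcs D"
    then obtain u v where q: "q = ?q (u, v)" and uv: "(u, v) \<in> parcs D" by auto
    then have "v \<in> V2" "u \<in> neighbors D v"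
      using A unfolding neighbors_iff by blast+
    with q show "q \<in> ?Q" by auto
  qed
  have fin: "finite ?Q"
    unfolding Q_eq using pair_fin_digraph.pair_finite_arcs[OF assms(1)] by simp
  obtain u0 v0 where "u0 \<in> V1" "v0 \<in> V2" using V by blast
  with connected_neighbor_exists[OF assms(2), of u0 v0] V have ne: "?Q \<noteq> {}"
    by blast
  \<comment> \<open>This equivalence serves both directions: at \<open>k = Max ?Q\<close> it
    validates the two-label numbering, and for any other numbering it bounds the largest label from
    below.\<close>
  have bound_iff: "Max ?Q \<le> int k \<longleftrightarrow> (\<forall>(u, v)\<in>parcs D. degree D u < k * degree D v)" for k
  proof -
    have "degree D v > 0" if "(u, v) \<in> parcs D" for u v
      using degree_pos[OF assms(1)] that by (metis neighbors_iff)
    then have "(\<forall>q\<in>?Q. q \<le> int k) \<longleftrightarrow> (\<forall>(u, v)\<in>parcs D. degree D u < k * degree D v)"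
      unfolding Q_eq by (fastforce simp: floor_quotient_plus_one_le_iff)
    then show ?thesis unfolding Max_le_iff[OF fin ne] .
  qed
  define k where "k = nat (Max ?Q)"
  \<comment> \<open>Every element of \<open>?Q\<close> is a nonnegative floor plus 1. Hence
    \<open>nat\<close> loses nothing in the definition of \<open>k\<close>, and \<open>k\<close> is
    an admissible label.\<close>
  have "Max ?Q > 0"
  proof -
    have "Max ?Q \<in> ?Q" using fin ne by (rule Max_in)
    then show ?thesis by (auto simp: floor_divide_of_nat_eq)
  qed
  then have k: "int k = Max ?Q" "k > 0" by (simp_all add: k_def)
  have "topological_additive_k_numbering D k (\<lambda>v. if v \<in> V1 then k else 1)"
    using bound_iff[of k] k by (intro two_label_k_numbering[OF assms(3)]) auto
  then have ex: "\<exists>f. topological_additive_k_numbering D k f" by blast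
  have "eta_t D = k"
    unfolding eta_t_def
  proof (rule Least_equality)
    show "\<exists>f. topological_additive_k_numbering D k f" by (fact ex)
  next
    fix m assume "\<exists>f. topological_additive_k_numbering D m f"
    then have "\<forall>(u, v)\<in>parcs D. degree D u < m * degree D v"
      using k_numbering_degree_less[OF assms(1)] by blast
    then show "k \<le> m" using bound_iff[of m] k(1) by simp
  qed
  with k(1) ex show ?thesis by (auto simp: topological_additive_k_numbering_def)
qed

end
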